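(* Let $n\ge1$ be an integer. (1) Let $a,b\in\mathbb{C}$ and $\mathbf{T}_n=\mathrm{tridiag}(a,b,a)\in\mathbb{C}^{n\times n}$. Then for all $i,j\in\{1,\dots,n\}$, $$\left|\bigl(\exp(\mathbf{T}_n)\bigr)_{ij}\right|\le 2e^{\operatorname{Re}(b)}\left(\frac{|a|e}{n+1}\right)^{n+1}+e^{\operatorname{Re}(b)+2|a|}\left(\frac{|a|^{|i-j|}}{|i-j|!}+\frac{|a|^{i+j}}{(i+j)!}\right).$$ (2) Let $a,b,c\in\mathbb{C}$ with $a\neq0$ and $c\ne0$, let $\mathbf{A}_n=\mathrm{tridiag}(a,b,c)\in\mathbb{C}^{n\times n}$, and let $z=c\sqrt{a/c}$. Then for all $i,j\in\{1,\dots,n\}$, $$\left|\bigl(\exp(\mathbf{A}_n)\bigr)_{ij}\right|\le 2\left|\sqrt{\frac{a}{c}}\right|^{i-j}e^{\operatorname{Re}(b)}\left(\frac{|z|e}{n+1}\right)^{n+1}+e^{\operatorname{Re}(b)+2|z|}\left|\sqrt{\frac{a}{c}}\right|^{i-j}\left(\frac{|z|^{|i-j|}}{|i-j|!}+\frac{|z|^{i+j}}{(i+j)!}\right).$$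
   Context: $\mathrm{tridiag}(a,b,c)$ denotes the $n\times n$ tridiagonal Toeplitz matrix with $a$ on the sub-diagonal, $b$ on the main diagonal, $c$ on the super-diagonal, and all other entries zero. $\exp$ is the matrix exponential, the number $e$ is Euler's number, and $0^0=1$. The bound in (2) does not depend on which square root of $a/c$ is chosen. *)

theory Defs
  imports Complex_Main "Jordan_Normal_Form.Matrix"
begin

(* Entry (i, j) is in row i and column j, both counted from 0. *)
definition tridiag :: "nat \<Rightarrow> complex \<Rightarrow> complex \<Rightarrow> complex \<Rightarrow> complex mat" where
  "tridiag n a b c = mat n n (\<lambda>(i, j).
     if i = Suc j then a else if i = j then b else if j = Suc i then c else 0)"

(* The power series of exp, summed entry by entry; for a square matrix every such series
   converges (lemma summable_mat_exp_entry). *)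
definition mat_exp :: "complex mat \<Rightarrow> complex mat" where
  "mat_exp A = mat (dim_row A) (dim_row A)
     (\<lambda>(i, j). \<Sum>k. (A ^\<^sub>m k) $$ (i, j) / fact k)"

lemma pow_mat_entry_bound:
  fixes A :: "complex mat"
  assumes A: "A \<in> carrier_mat n n"
    and M: "\<And>i j. i < n \<Longrightarrow> j < n \<Longrightarrow> norm (A $$ (i, j)) \<le> M"
    and "i < n" "j < n"
  shows "norm ((A ^\<^sub>m k) $$ (i, j)) \<le> (real n * M) ^ k"
  using assms(3,4)
proof (induction k arbitrary: i j)
  case 0
  then show ?case using A by simp
next
  case (Suc k)
  have P: "A ^\<^sub>m k \<in> carrier_mat n n"
    using A by (rule pow_carrier_mat)
  have "(A ^\<^sub>m Suc k) $$ (i, j) = (\<Sum>l<n. (A ^\<^sub>m k) $$ (i, l) * A $$ (l, j))"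
    using A P Suc.prems by (auto simp: scalar_prod_def atLeast0LessThan intro!: sum.cong)
  also have "norm \<dots> \<le> (\<Sum>l<n. norm ((A ^\<^sub>m k) $$ (i, l)) * norm (A $$ (l, j)))"
    by (rule order_trans[OF norm_sum]) (simp add: norm_mult)
  also have "\<dots> \<le> (\<Sum>l<n. (real n * M) ^ k * M)"
  proof (rule sum_mono)
    fix l assume l: "l \<in> {..<n}"
    have IH: "norm ((A ^\<^sub>m k) $$ (i, l)) \<le> (real n * M) ^ k"
      using Suc l by simp
    show "norm ((A ^\<^sub>m k) $$ (i, l)) * norm (A $$ (l, j)) \<le> (real n * M) ^ k * M"
      by (rule mult_mono[OF IH M]) (use l Suc.prems order_trans[OF norm_ge_zero IH] in auto)
  qed
  finally show ?case by (simp add: algebra_simps)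
qed

lemma summable_mat_exp_entry:
  fixes A :: "complex mat"
  assumes A: "A \<in> carrier_mat n n" and "i < n" "j < n"
  shows "summable (\<lambda>k. (A ^\<^sub>m k) $$ (i, j) / fact k)"
proof -
  define M where "M = (\<Sum>p\<in>{..<n} \<times> {..<n}. norm (A $$ p))"
  have M: "norm (A $$ (i, j)) \<le> M" if "i < n" "j < n" for i j
    unfolding M_def using that by (intro member_le_sum) auto
  show ?thesis
  proof (rule summable_comparison_test')
    show "summable (\<lambda>k. inverse (fact k) * (real n * M) ^ k)"
      by (rule summable_exp)
    show "norm ((A ^\<^sub>m k) $$ (i, j) / fact k) \<le> inverse (fact k) * (real n * M) ^ k" for k
      using pow_mat_entry_bound[OF A M assms(2,3), of k]
      by (simp add: norm_divide divide_simps)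
  qed
qed

end

(* Write the matrix as b I + z X with X = tridiag(s, 0, 1/s), so that its exponential is e^b exp(z X).
   A power of X expands into walks on the path {1..n}: the (i, j) entry of X^k is s^(i-j) times the
   number of walks of length k from i to j. Dropping the boundary, this number is at most the number
   of walks on the integers with displacement d = |i-j|, namely a binomial coefficient
   (k choose m) with m >= d or k - m >= d, hence at most (k choose d) 2^(k-d). Summing the
   exponential series yields |s|^(i-j) e^(Re b + 2|z|) |z|^d / d!, a single term of the claimed
   bound; the other terms are nonnegative. *)
theory Submission
  imports Defs
begin

section \<open>Counting walks on the integers\<close>

text \<open>The number of walks with \<open>k\<close> steps of size 1 on the integers that have
  displacement \<open>d\<close>; the recursion splits off one step. Letting \<open>d\<close> range
  over all integers keeps it free of boundary cases.\<close>

primrec int_walks :: "nat \<Rightarrow> int \<Rightarrow> nat" where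
  "int_walks 0 d = (if d = 0 then 1 else 0)"
| "int_walks (Suc k) d = int_walks k (d - 1) + int_walks k (d + 1)"

lemma int_walks_odd: "odd (int k + d) \<Longrightarrow> int_walks k d = 0"
  by (induction k arbitrary: d) auto

text \<open>A walk with \<open>m\<close> up-steps and \<open>k - m\<close> down-steps has
  displacement \<open>2 * m - k\<close>. In the variable \<open>m\<close> the recursion is Pascal's
  rule. Only negative \<open>m\<close> needs its own clause, since \<open>nat\<close> would send it
  to 0; for \<open>m > k\<close> the binomial coefficient vanishes by itself.\<close>

lemma int_walks_eq_choose:
  "int_walks k (2 * m - int k) = (if m < 0 then 0 else k choose nat m)"
proof (induction k arbitrary: m)
  case 0
  then show ?case by auto
next
  case (Suc k)
  have "int_walks (Suc k) (2 * m - int (Suc k))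
      = int_walks k (2 * (m - 1) - int k) + int_walks k (2 * m - int k)"
    by (simp add: algebra_simps)
  also have "\<dots> = (if m < 0 then 0 else Suc k choose nat m)"
  proof (cases "m \<le> 0")
    case False
    then have "nat m = Suc (nat (m - 1))" by simp
    with False Suc.IH[of m] Suc.IH[of "m - 1"] show ?thesis by simp
  qed (use Suc.IH[of m] Suc.IH[of "m - 1"] in auto)
  finally show ?case .
qed

text \<open>Double counting: an \<open>m\<close>-subset contains at least one
  \<open>d\<close>-subset, and a given \<open>d\<close>-subset extends to an \<open>m\<close>-subset
  by a subset of the other \<open>k - d\<close> elements, in at most \<open>2 ^ (k - d)\<close>
  ways.\<close>

lemma binomial_le_binomial_mult_power2:
  assumes "d \<le> m" "m \<le> k"
  shows "k choose m \<le> (k choose d) * 2 ^ (k - d)"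
proof -
  have "1 \<le> m choose d"
    using assms by (simp add: Suc_le_eq)
  then have "k choose m \<le> (k choose m) * (m choose d)"
    by simp
  also have "\<dots> = (k choose d) * ((k - d) choose (m - d))"
    using assms by (rule choose_mult)
  also have "\<dots> \<le> (k choose d) * 2 ^ (k - d)"
    by (intro mult_left_mono binomial_le_pow2) simp
  finally show ?thesis .
qed

text \<open>With \<open>m\<close> up-steps, the distance from the start is at most \<open>m\<close>
  if \<open>d\<close> is nonnegative and at most \<open>k - m\<close> otherwise. The previous bound
  applies directly in the first case, and after reflecting the binomial coefficient in the
  second.\<close>

lemma int_walks_le: "int_walks k d \<le> (k choose nat \<bar>d\<bar>) * 2 ^ (k - nat \<bar>d\<bar>)"
proof (cases "odd (int k + d)")
  case False
  then have "even (int k + d)" by simp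
  then obtain m where m: "int k + d = 2 * m" by (rule evenE)
  then have d: "d = 2 * m - int k" by simp
  show ?thesis
  proof (cases "m < 0 \<or> m > int k")
    case True
    then have "int_walks k d = 0"
      unfolding d int_walks_eq_choose by (auto simp: binomial_eq_0_iff)
    then show ?thesis by simp
  next
    case in_range: False
    then have eq: "int_walks k d = k choose nat m"
      unfolding d int_walks_eq_choose by auto
    have mk: "nat m \<le> k" using in_range by auto
    show ?thesis
    proof (cases "d \<ge> 0")
      case True
      then have "nat \<bar>d\<bar> \<le> nat m" using d in_range by auto
      from binomial_le_binomial_mult_power2[OF this mk] show ?thesis
        unfolding eq .
    next
      case False
      then have "nat \<bar>d\<bar> \<le> k - nat m" using d in_range by auto
      from binomial_le_binomial_mult_power2[OF this] show ?thesis
        unfolding eq binomial_symmetric[OF mk] by simp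
    qed
  qed
qed (simp add: int_walks_odd)

section \<open>Powers of tridiagonal matrices\<close>

lemma tridiag_carrier [simp]: "tridiag n a b c \<in> carrier_mat n n"
  by (simp add: tridiag_def)

lemma pow_mat_Suc_entry:
  fixes A :: "'a :: comm_semiring_1 mat"
  assumes "A \<in> carrier_mat n n" "i < n" "j < n"
  shows "(A ^\<^sub>m Suc k) $$ (i, j) = (\<Sum>l<n. (A ^\<^sub>m k) $$ (i, l) * A $$ (l, j))"
  using assms pow_carrier_mat[OF assms(1), of k]
  by (auto simp: scalar_prod_def atLeast0LessThan intro!: sum.cong)

text \<open>The last factor contributes only through the neighbours \<open>j + 1\<close> and
  \<open>j - 1\<close> of \<open>j\<close>, with weights \<open>s\<close> and
  \<open>inverse s\<close>, which turn their powers of \<open>s\<close> into that of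
  \<open>j\<close>. It is an inequality because walks on the integers may leave the index
  range.\<close>

lemma norm_pow_tridiag_entry_le:
  assumes s: "s \<noteq> 0" and ij: "i < n" "j < n"
  shows "cmod ((tridiag n s 0 (inverse s) ^\<^sub>m k) $$ (i, j))
    \<le> cmod s powi (int i - int j) * real (int_walks k (int j - int i))"
  using ij(2)
proof (induction k arbitrary: j)
  case 0
  then show ?case using ij by (auto simp: tridiag_def)
next
  case (Suc k)
  let ?X = "tridiag n s 0 (inverse s)"
  let ?r = "cmod s powi (int i - int j)"
  have r: "cmod s \<noteq> 0" using s by simp
  have "(?X ^\<^sub>m Suc k) $$ (i, j) = (\<Sum>l<n. (?X ^\<^sub>m k) $$ (i, l) * ?X $$ (l, j))"
    using ij Suc.prems by (intro pow_mat_Suc_entry) auto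
  also have "\<dots> = (\<Sum>l<n. (if l = Suc j then (?X ^\<^sub>m k) $$ (i, l) * s else 0)
        + (if Suc l = j then (?X ^\<^sub>m k) $$ (i, l) * inverse s else 0))"
    using Suc.prems by (intro sum.cong) (auto simp: tridiag_def)
  also have "\<dots> = (\<Sum>l<n. if l = Suc j then (?X ^\<^sub>m k) $$ (i, l) * s else 0)
        + (\<Sum>l<n. if Suc l = j then (?X ^\<^sub>m k) $$ (i, l) * inverse s else 0)"
    by (rule sum.distrib)
  also have "cmod \<dots> \<le> ?r * real (int_walks k (int j - int i + 1))
        + ?r * real (int_walks k (int j - int i - 1))"
  proof (rule norm_triangle_mono)
    show "cmod (\<Sum>l<n. if l = Suc j then (?X ^\<^sub>m k) $$ (i, l) * s else 0)
        \<le> ?r * real (int_walks k (int j - int i + 1))"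
    \<comment> \<open>In the last column the neighbour \<open>j + 1\<close> is missing: the sum is 0
      and the bound is nonnegative. The case \<open>j = 0\<close> below is the mirror image.\<close>
    proof (cases "Suc j < n")
      case True
      have "?r = cmod s powi (int i - int (Suc j)) * cmod s"
        using power_int_add_1[of "cmod s" "int i - int (Suc j)"] r by simp
      moreover have "cmod ((?X ^\<^sub>m k) $$ (i, Suc j) * s)
          \<le> (cmod s powi (int i - int (Suc j)) * real (int_walks k (int (Suc j) - int i))) * cmod s"
        unfolding norm_mult by (intro mult_right_mono Suc.IH True) simp
      ultimately show ?thesis
        using True by (simp add: algebra_simps)
    qed simp
    show "cmod (\<Sum>l<n. if Suc l = j then (?X ^\<^sub>m k) $$ (i, l) * inverse s else 0)
        \<le> ?r * real (int_walks k (int j - int i - 1))"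
    proof (cases j)
      case (Suc j')
      have j': "j' < n" using Suc Suc.prems by simp
      have r': "?r = cmod s powi (int i - int j') * inverse (cmod s)"
        using power_int_add_1[of "cmod s" "int i - int j"] r Suc by (simp add: field_simps)
      have "cmod ((?X ^\<^sub>m k) $$ (i, j') * inverse s)
          \<le> (cmod s powi (int i - int j') * real (int_walks k (int j' - int i))) * inverse (cmod s)"
        unfolding norm_mult norm_inverse by (intro mult_right_mono Suc.IH j') simp
      with r' Suc j' show ?thesis
        by (simp add: algebra_simps)
    qed simp
  qed
  also have "\<dots> = ?r * real (int_walks (Suc k) (int j - int i))"
    by (simp add: algebra_simps)
  finally show ?case .
qed

text \<open>The binomial theorem for \<open>b I + z X\<close>, whose two summands commute, proved
  entry by entry through Pascal's rule.\<close>

lemma pow_mat_scalar_plus_entry: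
  fixes A X :: "'a :: comm_semiring_1 mat"
  assumes A: "A \<in> carrier_mat n n" and X: "X \<in> carrier_mat n n"
    and AX: "\<And>i j. i < n \<Longrightarrow> j < n \<Longrightarrow> A $$ (i, j) = (if i = j then b else 0) + z * X $$ (i, j)"
    and ij: "i < n" "j < n"
  shows "(A ^\<^sub>m k) $$ (i, j)
    = (\<Sum>m\<le>k. of_nat (k choose m) * z ^ m * b ^ (k - m) * (X ^\<^sub>m m) $$ (i, j))"
  using ij(2)
proof (induction k arbitrary: j)
  case 0
  then show ?case using ij A X by auto
next
  case (Suc k)
  let ?t = "\<lambda>k m. of_nat (k choose m) * z ^ m * b ^ (k - m)"
  have "(A ^\<^sub>m Suc k) $$ (i, j) = (\<Sum>l<n. (A ^\<^sub>m k) $$ (i, l) * A $$ (l, j))"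
    by (rule pow_mat_Suc_entry[OF A ij(1) Suc.prems])
  also have "\<dots> = (\<Sum>l<n. (if l = j then (A ^\<^sub>m k) $$ (i, l) * b else 0)
      + (A ^\<^sub>m k) $$ (i, l) * (z * X $$ (l, j)))"
    using Suc.prems by (intro sum.cong) (auto simp: AX algebra_simps)
  also have "\<dots> = (A ^\<^sub>m k) $$ (i, j) * b + (\<Sum>l<n. (A ^\<^sub>m k) $$ (i, l) * (z * X $$ (l, j)))"
    using Suc.prems by (simp add: sum.distrib)
  also have "(\<Sum>l<n. (A ^\<^sub>m k) $$ (i, l) * (z * X $$ (l, j)))
      = (\<Sum>l<n. \<Sum>m\<le>k. ?t k m * (X ^\<^sub>m m) $$ (i, l) * (z * X $$ (l, j)))"
    by (intro sum.cong) (simp_all add: Suc.IH sum_distrib_right)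
  also have "\<dots> = (\<Sum>m\<le>k. ?t k m * z * (\<Sum>l<n. (X ^\<^sub>m m) $$ (i, l) * X $$ (l, j)))"
    by (subst sum.swap) (simp add: sum_distrib_left mult_ac)
  also have "\<dots> = (\<Sum>m\<le>k. ?t k m * z * (X ^\<^sub>m Suc m) $$ (i, j))"
    by (intro sum.cong) (simp_all only: pow_mat_Suc_entry[OF X ij(1) Suc.prems])
  \<comment> \<open>The extra term at \<open>m = Suc k\<close> is 0, as
    \<open>k choose Suc k = 0\<close>. It is added so that splitting off \<open>m = 0\<close> leaves
    a sum over the same range as the other one.\<close>
  also have "(A ^\<^sub>m k) $$ (i, j) * b
      = (\<Sum>m\<le>Suc k. of_nat (k choose m) * z ^ m * b ^ (Suc k - m) * (X ^\<^sub>m m) $$ (i, j))"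
    unfolding Suc.IH[OF Suc.prems] sum_distrib_right sum.atMost_Suc
    by (auto simp: binomial_eq_0 Suc_diff_le mult_ac simp del: pow_mat.simps intro!: sum.cong)
  also have "\<dots> = b ^ Suc k * (X ^\<^sub>m 0) $$ (i, j)
      + (\<Sum>m\<le>k. of_nat (k choose Suc m) * z ^ Suc m * b ^ (k - m) * (X ^\<^sub>m Suc m) $$ (i, j))"
    by (subst sum.atMost_Suc_shift) (simp del: pow_mat.simps)
  also have "\<dots> + (\<Sum>m\<le>k. ?t k m * z * (X ^\<^sub>m Suc m) $$ (i, j))
      = b ^ Suc k * (X ^\<^sub>m 0) $$ (i, j)
      + (\<Sum>m\<le>k. of_nat (Suc k choose Suc m) * z ^ Suc m * b ^ (k - m) * (X ^\<^sub>m Suc m) $$ (i, j))"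
    by (simp del: pow_mat.simps add: add.assoc sum.distrib[symmetric] algebra_simps)
  also have "\<dots> = (\<Sum>m\<le>Suc k. ?t (Suc k) m * (X ^\<^sub>m m) $$ (i, j))"
    by (subst sum.atMost_Suc_shift) (simp del: pow_mat.simps binomial_Suc_Suc)
  finally show ?case .
qed

section \<open>Summing the exponential series\<close>

text \<open>The terms with \<open>k < d\<close> vanish. For \<open>k = q + d\<close>, dividing the
  binomial coefficient by \<open>k!\<close> leaves \<open>1 / (q! d!)\<close>, so the exponential
  series of \<open>2 * x\<close> splits off.\<close>

lemma binomial_power2_exp_sums:
  fixes x :: real
  shows "(\<lambda>k. real ((k choose d) * 2 ^ (k - d)) * x ^ k / fact k) sums (exp (2 * x) * (x ^ d / fact d))"
proof -
  let ?f = "\<lambda>k. real ((k choose d) * 2 ^ (k - d)) * x ^ k / fact k"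
  have "?f (q + d) = (2 * x) ^ q / fact q * (x ^ d / fact d)" for q
    using binomial_fact[of d "q + d", where ?'a = real]
    by (simp add: power_add power_mult_distrib mult_ac)
  moreover have "(\<lambda>q. (2 * x) ^ q / fact q * (x ^ d / fact d)) sums (exp (2 * x) * (x ^ d / fact d))"
    using exp_converges[of "2 * x"] by (intro sums_mult2) (simp add: divide_inverse mult_ac)
  ultimately have "(\<lambda>q. ?f (q + d)) sums (exp (2 * x) * (x ^ d / fact d))"
    by (simp only:)
  moreover have "?f k = 0" if "k < d" for k
    using that by simp
  ultimately show ?thesis
    by (subst sums_zero_iff_shift[symmetric]) auto
qed

text \<open>The common source of both bounds: the matrix is \<open>b I + z X\<close>, and each entry
  of its exponential is the Cauchy product of the series for \<open>exp (z X)\<close> and for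
  \<open>exp b\<close>.\<close>

lemma mat_exp_tridiag_entry_le:
  assumes s: "s \<noteq> 0" and ij: "i < n" "j < n"
  shows "cmod (mat_exp (tridiag n (z * s) b (z * inverse s)) $$ (i, j))
    \<le> exp (Re b + 2 * cmod z) * cmod s powi (int i - int j)
      * (cmod z ^ nat \<bar>int i - int j\<bar> / fact (nat \<bar>int i - int j\<bar>))"
proof -
  let ?A = "tridiag n (z * s) b (z * inverse s)" and ?X = "tridiag n s 0 (inverse s)"
  let ?r = "cmod s powi (int i - int j)"
  define d where "d = nat \<bar>int i - int j\<bar>"
  \<comment> \<open>\<open>u\<close> holds the terms of the entry of \<open>exp (z X)\<close>,
    \<open>v\<close> those of \<open>exp b\<close>, and \<open>g\<close> is the majorant of
    \<open>u\<close> given by the walk count.\<close>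
  define u where "u m = z ^ m * (?X ^\<^sub>m m) $$ (i, j) / fact m" for m
  define v where "v m = b ^ m / fact m" for m
  define g where "g m = ?r * (real ((m choose d) * 2 ^ (m - d)) * cmod z ^ m / fact m)" for m
  have u_le: "cmod (u m) \<le> g m" for m
  proof -
    have "int_walks m (int j - int i) \<le> (m choose d) * 2 ^ (m - d)"
      using int_walks_le[of m "int j - int i"] by (simp add: d_def abs_minus_commute)
    then have "real (int_walks m (int j - int i)) \<le> real ((m choose d) * 2 ^ (m - d))"
      by (simp only: of_nat_le_iff)
    then have "cmod ((?X ^\<^sub>m m) $$ (i, j)) \<le> ?r * real ((m choose d) * 2 ^ (m - d))"
      by (intro order_trans[OF norm_pow_tridiag_entry_le[OF s ij]] mult_left_mono) auto
    then have "cmod z ^ m * cmod ((?X ^\<^sub>m m) $$ (i, j)) / fact m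
        \<le> cmod z ^ m * (?r * real ((m choose d) * 2 ^ (m - d))) / fact m"
      by (intro divide_right_mono mult_left_mono) auto
    then show ?thesis
      by (simp add: u_def g_def norm_mult norm_divide norm_power mult_ac)
  qed
  have g_sums: "g sums (?r * (exp (2 * cmod z) * (cmod z ^ d / fact d)))"
    unfolding g_def by (intro sums_mult binomial_power2_exp_sums)
  have u_summable: "summable (\<lambda>m. cmod (u m))"
    using u_le by (intro summable_comparison_test'[OF sums_summable[OF g_sums]]) simp
  have v: "v = (\<lambda>m. b ^ m /\<^sub>R fact m)"
    by (simp add: fun_eq_iff v_def scaleR_conv_of_real divide_inverse mult_ac)
  have v_sums: "v sums exp b"
    unfolding v by (rule exp_converges)
  have v_summable: "summable (\<lambda>m. cmod (v m))"
    unfolding v by (rule summable_norm_exp)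
  have "?A $$ (p, q) = (if p = q then b else 0) + z * ?X $$ (p, q)" if "p < n" "q < n" for p q
    using that by (simp add: tridiag_def)
  from pow_mat_scalar_plus_entry[OF _ _ this ij]
  \<comment> \<open>Dividing \<open>k choose m\<close> by \<open>k!\<close> gives
    \<open>1 / (m! (k - m)!)\<close>, which makes the binomial expansion a convolution.\<close>
  have pow: "(?A ^\<^sub>m k) $$ (i, j) / fact k = (\<Sum>m\<le>k. u m * v (k - m))" for k
    by (simp add: sum_divide_distrib u_def v_def binomial_fact field_simps)
  have "mat_exp ?A $$ (i, j) = (\<Sum>k. (?A ^\<^sub>m k) $$ (i, j) / fact k)"
    using ij by (simp add: mat_exp_def tridiag_def)
  also have "\<dots> = suminf u * exp b"
    unfolding pow using sums_unique[OF Cauchy_product_sums[OF u_summable v_summable]]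
      sums_unique[OF v_sums] by simp
  finally have "cmod (mat_exp ?A $$ (i, j)) = cmod (suminf u) * exp (Re b)"
    by (simp add: norm_mult)
  also have "cmod (suminf u) \<le> ?r * (exp (2 * cmod z) * (cmod z ^ d / fact d))"
    using summable_norm[OF u_summable] suminf_le[OF u_le u_summable sums_summable[OF g_sums]]
      sums_unique[OF g_sums] by simp
  finally show ?thesis
    by (simp add: d_def exp_add mult_ac)
qed

theorem theorem4p4:
  fixes n :: nat
  assumes "n \<ge> 1"
  shows "(\<forall>(a :: complex) (b :: complex). \<forall>i \<in> {1..n}. \<forall>j \<in> {1..n}.
            cmod (mat_exp (tridiag n a b a) $$ (i - 1, j - 1))
              \<le> 2 * exp (Re b) * (cmod a * exp 1 / (real n + 1)) ^ (n + 1)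
                + exp (Re b + 2 * cmod a)
                  * (cmod a ^ nat \<bar>int i - int j\<bar> / fact (nat \<bar>int i - int j\<bar>)
                     + cmod a ^ (i + j) / fact (i + j)))
       \<and> (\<forall>(a :: complex) (b :: complex) (c :: complex) (s :: complex) (z :: complex).
            a \<noteq> 0 \<longrightarrow> c \<noteq> 0 \<longrightarrow> s ^ 2 = a / c \<longrightarrow> z = c * s \<longrightarrow>
            (\<forall>i \<in> {1..n}. \<forall>j \<in> {1..n}.
              cmod (mat_exp (tridiag n a b c) $$ (i - 1, j - 1))
                \<le> 2 * (cmod s powi (int i - int j)) * exp (Re b)
                    * (cmod z * exp 1 / (real n + 1)) ^ (n + 1)
                  + exp (Re b + 2 * cmod z) * (cmod s powi (int i - int j))
                    * (cmod z ^ nat \<bar>int i - int j\<bar> / fact (nat \<bar>int i - int j\<bar>)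
                       + cmod z ^ (i + j) / fact (i + j))))"
proof (intro conjI allI ballI impI)
  fix a b :: complex and i j :: nat
  assume "i \<in> {1..n}" "j \<in> {1..n}"
  \<comment> \<open>The shift from indices counted from 1 to indices counted from 0 cancels in the
    difference.\<close>
  then have ij: "i - 1 < n" "j - 1 < n" "int (i - 1) - int (j - 1) = int i - int j"
    by auto
  have "cmod (mat_exp (tridiag n a b a) $$ (i - 1, j - 1))
      \<le> exp (Re b + 2 * cmod a) * (cmod a ^ nat \<bar>int i - int j\<bar> / fact (nat \<bar>int i - int j\<bar>))"
    \<comment> \<open>The symmetric case is \<open>s = 1\<close>, \<open>z = a\<close>, where all
      powers of \<open>s\<close> are 1.\<close>
    using mat_exp_tridiag_entry_le[of 1 "i - 1" n "j - 1" a b] ij by simp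
  also have "\<dots> \<le> 2 * exp (Re b) * (cmod a * exp 1 / (real n + 1)) ^ (n + 1)
      + exp (Re b + 2 * cmod a) * (cmod a ^ nat \<bar>int i - int j\<bar> / fact (nat \<bar>int i - int j\<bar>)
        + cmod a ^ (i + j) / fact (i + j))"
    by (rule add_increasing[OF _ mult_left_mono]) auto
  finally show "cmod (mat_exp (tridiag n a b a) $$ (i - 1, j - 1)) \<le> \<dots>" .
next
  fix a b c s z :: complex and i j :: nat
  assume ac: "a \<noteq> 0" "c \<noteq> 0" and sz: "s ^ 2 = a / c" "z = c * s"
    and "i \<in> {1..n}" "j \<in> {1..n}"
  then have ij: "i - 1 < n" "j - 1 < n" "int (i - 1) - int (j - 1) = int i - int j"
    by auto
  have s: "s \<noteq> 0" using ac sz by auto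
  \<comment> \<open>Since \<open>z * s = c * s ^ 2\<close>, either square root \<open>s\<close> of
    \<open>a / c\<close> brings the matrix into the required form.\<close>
  have a: "z * s = a" and c: "z * inverse s = c"
    using ac sz s by (auto simp: power2_eq_square field_simps)
  have "cmod (mat_exp (tridiag n a b c) $$ (i - 1, j - 1))
      \<le> exp (Re b + 2 * cmod z) * (cmod s powi (int i - int j))
        * (cmod z ^ nat \<bar>int i - int j\<bar> / fact (nat \<bar>int i - int j\<bar>))"
    using mat_exp_tridiag_entry_le[OF s ij(1,2), of z b] unfolding a c ij(3) .
  also have "\<dots> \<le> 2 * (cmod s powi (int i - int j)) * exp (Re b)
        * (cmod z * exp 1 / (real n + 1)) ^ (n + 1)
      + exp (Re b + 2 * cmod z) * (cmod s powi (int i - int j))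
        * (cmod z ^ nat \<bar>int i - int j\<bar> / fact (nat \<bar>int i - int j\<bar>)
          + cmod z ^ (i + j) / fact (i + j))"
    by (rule add_increasing[OF _ mult_left_mono]) auto
  finally show "cmod (mat_exp (tridiag n a b c) $$ (i - 1, j - 1)) \<le> \<dots>" .
qed

end
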